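(* Let $(\mathfrak g,\tau,C,h)$ be a modular compactly causal symmetric Lie algebra, $G$ a connected Lie group with Lie algebra $\mathfrak g$ whose universal complexification $\eta_G\colon G\to G_{\mathbb C}$ has discrete kernel, $\tau^G$ an involutive automorphism of $G$ integrating $\tau$, $H\subseteq G^{\tau^G}$ an open subgroup with $\mathrm{Ad}(H)C=C$, and assume that $\tau_h$ integrates to an involutive automorphism $\tau_h^G$ of $G$ with $\tau_h^G(H)=H$. Let $M=G/H$, $M^\alpha=\{gH\in M:\mathrm{Ad}(g)^{-1}h\in\mathfrak h\}$, $G^h=\{g\in G:\mathrm{Ad}(g)h=h\}$ and $\mathcal O_h=\mathrm{Ad}(G)h$. Then the map $$\Gamma\colon M^\alpha/G^h\to(\mathcal O_h\cap\mathfrak h)/H,\qquad G^hgH\mapsto\mathrm{Ad}(H)\mathrm{Ad}(g)^{-1}h,$$ from the set of $G^h$-orbits in $M^\alpha$ to the set of $\mathrm{Ad}(H)$-orbits in $\mathcal O_h\cap\mathfrak h$ is a (well-defined) bijection.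
   Context: A symmetric Lie algebra $(\mathfrak g,\tau)$ is a finite-dimensional real Lie algebra with an involutive automorphism; $\mathfrak h=\mathfrak g^\tau$, $\mathfrak q=\mathfrak g^{-\tau}$. $(\mathfrak g,\tau,C)$ is compactly causal if $C\subseteq\mathfrak q$ is a pointed (containing no line) generating closed convex cone invariant under $\langle e^{\mathrm{ad}\,\mathfrak h}\rangle$ such that for $x$ in its interior $\mathrm{ad}\,x$ is semisimple with purely imaginary spectrum. $h$ is an Euler element if $\mathrm{ad}\,h\ne0$ is diagonalizable with eigenvalues in $\{-1,0,1\}$; $\tau_h=e^{\pi i\,\mathrm{ad}\,h}$. $(\mathfrak g,\tau,C,h)$ is modular compactly causal if in addition $h\in\mathfrak h$ is an Euler element with $\tau_h(C)=-C$. $M^\alpha$ is the fixed point set of the flow $\alpha_t(gH)=\exp(th)gH$ on $M$. *)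

theory Defs
  imports
    "HOL-Analysis.Analysis"
    "HOL-Algebra.Group_Action"
    "HOL-Algebra.Generated_Groups"
begin

section \<open>Manifolds over the reals and over the complex numbers\<close>

text \<open>
  The coordinate space of dimension \<open>n\<close> over the field \<open>'k\<close> (real or complex) consists of the
  sequences supported on \<open>{..<n}\<close>, with the product topology. This way the dimension is an
  ordinary natural number that can be quantified over inside a formula.
\<close>

definition coord_space :: "nat \<Rightarrow> (nat \<Rightarrow> 'k::real_normed_field) set" where
  "coord_space n = {x. \<forall>i\<ge>n. x i = 0}"

text \<open>
  \<open>Ck n k V f\<close>: all iterated partial derivatives of \<open>f\<close> of order at most \<open>k\<close> exist and are
  continuous on the open set \<open>V\<close> of the \<open>n\<close>-dimensional coordinate space. Over the complex
  numbers the partial derivatives are the complex ones, so \<open>Ck n k V f\<close> with \<open>k > 0\<close> says that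
  \<open>f\<close> is holomorphic on \<open>V\<close>.
\<close>

fun Ck :: "nat \<Rightarrow> nat \<Rightarrow> (nat \<Rightarrow> 'k::real_normed_field) set \<Rightarrow> ((nat \<Rightarrow> 'k) \<Rightarrow> 'k) \<Rightarrow> bool" where
  "Ck n 0 V f \<longleftrightarrow> continuous_on V f"
| "Ck n (Suc k) V f \<longleftrightarrow> continuous_on V f \<and>
     (\<forall>i<n. (\<forall>x\<in>V. (\<lambda>t. f (x(i := t))) field_differentiable at (x i)) \<and>
            Ck n k V (\<lambda>x. deriv (\<lambda>t. f (x(i := t))) (x i)))"

definition Cinf :: "nat \<Rightarrow> (nat \<Rightarrow> 'k::real_normed_field) set \<Rightarrow> ((nat \<Rightarrow> 'k) \<Rightarrow> 'k) \<Rightarrow> bool" where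
  "Cinf n V f \<longleftrightarrow> (\<forall>k. Ck n k V f)"

record ('p, 'k) manifold =
  mtop :: "'p topology"
  mdim :: nat
  charts :: "('p set \<times> ('p \<Rightarrow> nat \<Rightarrow> 'k)) set"

definition smooth_manifold :: "('p, 'k::real_normed_field) manifold \<Rightarrow> bool" where
  "smooth_manifold M \<longleftrightarrow>
     Hausdorff_space (mtop M) \<and> second_countable (mtop M) \<and>
     (\<Union>(U, \<phi>)\<in>charts M. U) = topspace (mtop M) \<and>
     (\<forall>(U, \<phi>)\<in>charts M.
        openin (mtop M) U \<and>
        openin (top_of_set (coord_space (mdim M))) (\<phi> ` U) \<and>
        homeomorphic_map (subtopology (mtop M) U) (top_of_set (\<phi> ` U)) \<phi>) \<and>
     (\<forall>(U, \<phi>)\<in>charts M. \<forall>(V, \<psi>)\<in>charts M. \<forall>j<mdim M.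
        Cinf (mdim M) (\<phi> ` (U \<inter> V)) (\<lambda>x. \<psi> (inv_into U \<phi> x) j))"

definition smooth_on :: "('p, 'k::real_normed_field) manifold \<Rightarrow> 'p set \<Rightarrow> ('p \<Rightarrow> 'k) \<Rightarrow> bool" where
  "smooth_on M W f \<longleftrightarrow> openin (mtop M) W \<and>
     (\<forall>(U, \<phi>)\<in>charts M. Cinf (mdim M) (\<phi> ` (U \<inter> W)) (\<lambda>x. f (inv_into U \<phi> x)))"

text \<open>
  A continuous map is smooth (holomorphic, for \<open>'k = complex\<close>) if it pulls back smooth functions
  on open sets to smooth functions (F. Warner, Foundations of Differentiable Manifolds and Lie
  Groups, Definition 1.6).
\<close>

definition smooth_map ::
  "('p, 'k::real_normed_field) manifold \<Rightarrow> ('q, 'k) manifold \<Rightarrow> ('p \<Rightarrow> 'q) \<Rightarrow> bool" where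
  "smooth_map M N F \<longleftrightarrow> continuous_map (mtop M) (mtop N) F \<and>
     (\<forall>V f. smooth_on N V f \<longrightarrow> smooth_on M {x \<in> topspace (mtop M). F x \<in> V} (f \<circ> F))"

definition product_manifold ::
  "('p, 'k::real_normed_field) manifold \<Rightarrow> ('q, 'k) manifold \<Rightarrow> ('p \<times> 'q, 'k) manifold" where
  "product_manifold M N =
     \<lparr>mtop = prod_topology (mtop M) (mtop N),
      mdim = mdim M + mdim N,
      charts = {(U \<times> V, \<lambda>(x, y) i. if i < mdim M then \<phi> x i else \<psi> y (i - mdim M)) | U \<phi> V \<psi>.
                  (U, \<phi>) \<in> charts M \<and> (V, \<psi>) \<in> charts N}\<rparr>"

text \<open>The underlying real manifold of a complex manifold.\<close>

definition realification :: "('p, complex) manifold \<Rightarrow> ('p, real) manifold" where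
  "realification N =
     \<lparr>mtop = mtop N,
      mdim = 2 * mdim N,
      charts = {(U, \<lambda>x i. if even i then Re (\<phi> x (i div 2)) else Im (\<phi> x (i div 2))) | U \<phi>.
                  (U, \<phi>) \<in> charts N}\<rparr>"


section \<open>Lie groups\<close>

definition lie_group :: "'g monoid \<Rightarrow> ('g, 'k::real_normed_field) manifold \<Rightarrow> bool" where
  "lie_group G M \<longleftrightarrow> group G \<and> smooth_manifold M \<and> topspace (mtop M) = carrier G \<and>
     smooth_map (product_manifold M M) M (\<lambda>(x, y). x \<otimes>\<^bsub>G\<^esub> y) \<and>
     smooth_map M M (\<lambda>x. inv\<^bsub>G\<^esub> x)"

definition lie_hom ::
  "'g monoid \<Rightarrow> ('g, 'k::real_normed_field) manifold \<Rightarrow> 'l monoid \<Rightarrow> ('l, 'k) manifold \<Rightarrow> ('g \<Rightarrow> 'l) set"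
  where "lie_hom G M L N = {F \<in> hom G L. smooth_map M N F}"

definition involutive_lie_automorphism ::
  "'g monoid \<Rightarrow> ('g, real) manifold \<Rightarrow> ('g \<Rightarrow> 'g) \<Rightarrow> bool" where
  "involutive_lie_automorphism G M F \<longleftrightarrow>
     F \<in> iso G G \<and> smooth_map M M F \<and> (\<forall>x\<in>carrier G. F (F x) = x)"

text \<open>
  The complex Lie group \<open>(Gc, Mc)\<close> with \<open>\<eta>\<close> is the universal complexification of the real Lie
  group \<open>(G, M)\<close>. The test groups \<open>L\<close> are carried by subsets of the type of real numbers; this
  covers all complex Lie groups up to isomorphism because a second countable manifold has at most
  the cardinality of the continuum. Extensionality makes uniqueness a statement about the values
  on \<open>Gc\<close> only.
\<close>

definition universal_complexification ::
  "'g monoid \<Rightarrow> ('g, real) manifold \<Rightarrow> 'c monoid \<Rightarrow> ('c, complex) manifold \<Rightarrow> ('g \<Rightarrow> 'c) \<Rightarrow> bool"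
  where
  "universal_complexification G M Gc Mc \<eta> \<longleftrightarrow>
     lie_group Gc Mc \<and> \<eta> \<in> lie_hom G M Gc (realification Mc) \<and>
     (\<forall>(L :: real monoid) (N :: (real, complex) manifold). lie_group L N \<longrightarrow>
        (\<forall>f \<in> lie_hom G M L (realification N).
           \<exists>!F. F \<in> lie_hom Gc Mc L N \<inter> extensional (carrier Gc) \<and>
                (\<forall>x\<in>carrier G. F (\<eta> x) = f x)))"


section \<open>The Lie algebra of a Lie group and the adjoint representation\<close>

text \<open>
  Globally defined smooth functions are extended by zero to the whole type, and tangent vectors
  are derivations on them, extended by zero to non-smooth arguments.
\<close>

definition smooth_functions :: "('p, real) manifold \<Rightarrow> ('p \<Rightarrow> real) set" where
  "smooth_functions M =
     {f. smooth_on M (topspace (mtop M)) f \<and> (\<forall>x. x \<notin> topspace (mtop M) \<longrightarrow> f x = 0)}"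

definition tangent_space :: "('p, real) manifold \<Rightarrow> 'p \<Rightarrow> (('p \<Rightarrow> real) \<Rightarrow> real) set" where
  "tangent_space M p =
     {D. (\<forall>f\<in>smooth_functions M. \<forall>g\<in>smooth_functions M.
            D (\<lambda>x. f x + g x) = D f + D g \<and> D (\<lambda>x. f x * g x) = f p * D g + g p * D f) \<and>
         (\<forall>f\<in>smooth_functions M. \<forall>c. D (\<lambda>x. c * f x) = c * D f) \<and>
         (\<forall>f. f \<notin> smooth_functions M \<longrightarrow> D f = 0)}"

definition differential ::
  "('p, real) manifold \<Rightarrow> ('q, real) manifold \<Rightarrow> ('p \<Rightarrow> 'q) \<Rightarrow>
     (('p \<Rightarrow> real) \<Rightarrow> real) \<Rightarrow> ('q \<Rightarrow> real) \<Rightarrow> real" where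
  "differential M N F D =
     (\<lambda>f. if f \<in> smooth_functions N then D (\<lambda>x. if x \<in> topspace (mtop M) then f (F x) else 0)
          else 0)"

text \<open>The left-invariant vector field with value \<open>D\<close> at the identity, acting on functions.\<close>

definition left_invariant_field ::
  "'g monoid \<Rightarrow> (('g \<Rightarrow> real) \<Rightarrow> real) \<Rightarrow> ('g \<Rightarrow> real) \<Rightarrow> 'g \<Rightarrow> real" where
  "left_invariant_field G D f =
     (\<lambda>g. if g \<in> carrier G then D (\<lambda>x. if x \<in> carrier G then f (g \<otimes>\<^bsub>G\<^esub> x) else 0) else 0)"

text \<open>The value at the identity of the commutator of the left-invariant vector fields.\<close>

definition tangent_bracket ::
  "'g monoid \<Rightarrow> ('g, real) manifold \<Rightarrow>
     (('g \<Rightarrow> real) \<Rightarrow> real) \<Rightarrow> (('g \<Rightarrow> real) \<Rightarrow> real) \<Rightarrow> ('g \<Rightarrow> real) \<Rightarrow> real" where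
  "tangent_bracket G M D E =
     (\<lambda>f. if f \<in> smooth_functions M
          then D (left_invariant_field G E f) - E (left_invariant_field G D f) else 0)"

text \<open>
  \<open>\<iota>\<close> is an isomorphism from the Lie algebra \<open>'v\<close> with bracket \<open>br\<close> onto the tangent space of
  \<open>G\<close> at the identity with the bracket of left-invariant vector fields.
\<close>

definition lie_algebra_identification ::
  "('v::real_vector \<Rightarrow> 'v \<Rightarrow> 'v) \<Rightarrow> 'g monoid \<Rightarrow> ('g, real) manifold \<Rightarrow>
     ('v \<Rightarrow> ('g \<Rightarrow> real) \<Rightarrow> real) \<Rightarrow> bool" where
  "lie_algebra_identification br G M \<iota> \<longleftrightarrow>
     (\<forall>x y f. \<iota> (x + y) f = \<iota> x f + \<iota> y f) \<and>
     (\<forall>c x f. \<iota> (c *\<^sub>R x) f = c * \<iota> x f) \<and>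
     bij_betw \<iota> UNIV (tangent_space M \<one>\<^bsub>G\<^esub>) \<and>
     (\<forall>x y. \<iota> (br x y) = tangent_bracket G M (\<iota> x) (\<iota> y))"

definition integrates ::
  "('g, real) manifold \<Rightarrow> ('v \<Rightarrow> ('g \<Rightarrow> real) \<Rightarrow> real) \<Rightarrow> ('g \<Rightarrow> 'g) \<Rightarrow> ('v \<Rightarrow> 'v) \<Rightarrow> bool" where
  "integrates M \<iota> F A \<longleftrightarrow> (\<forall>x. differential M M F (\<iota> x) = \<iota> (A x))"

definition Ad ::
  "'g monoid \<Rightarrow> ('g, real) manifold \<Rightarrow> ('v \<Rightarrow> ('g \<Rightarrow> real) \<Rightarrow> real) \<Rightarrow> 'g \<Rightarrow> 'v \<Rightarrow> 'v" where
  "Ad G M \<iota> g x =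
     inv_into UNIV \<iota> (differential M M (\<lambda>y. g \<otimes>\<^bsub>G\<^esub> y \<otimes>\<^bsub>G\<^esub> inv\<^bsub>G\<^esub> g) (\<iota> x))"


section \<open>Linear algebra of endomorphisms\<close>

definition endo_exp :: "('v::real_normed_vector \<Rightarrow> 'v) \<Rightarrow> 'v \<Rightarrow> 'v" where
  "endo_exp A v = (\<Sum>n. (A ^^ n) v /\<^sub>R fact n)"

text \<open>The pair \<open>(a, b)\<close> stands for the element \<open>a + \<i> b\<close> of the complexification of \<open>'v\<close>.\<close>

definition cscale :: "complex \<Rightarrow> 'v::real_vector \<times> 'v \<Rightarrow> 'v \<times> 'v" where
  "cscale c w = (Re c *\<^sub>R fst w - Im c *\<^sub>R snd w, Re c *\<^sub>R snd w + Im c *\<^sub>R fst w)"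

definition complexify :: "('v \<Rightarrow> 'v) \<Rightarrow> 'v \<times> 'v \<Rightarrow> 'v \<times> 'v" where
  "complexify A w = (A (fst w), A (snd w))"

definition complex_spectrum :: "('v::real_vector \<Rightarrow> 'v) \<Rightarrow> complex set" where
  "complex_spectrum A = {c. \<exists>w. w \<noteq> 0 \<and> complexify A w = cscale c w}"

definition semisimple_endo :: "('v::real_vector \<Rightarrow> 'v) \<Rightarrow> bool" where
  "semisimple_endo A \<longleftrightarrow>
     (\<forall>W. subspace W \<and> A ` W \<subseteq> W \<longrightarrow>
        (\<exists>W'. subspace W' \<and> A ` W' \<subseteq> W' \<and> W \<inter> W' = {0} \<and> {w + w' | w w'. w \<in> W \<and> w' \<in> W'} = UNIV))"


section \<open>Modular compactly causal symmetric Lie algebras\<close>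

definition lie_bracket :: "('v::euclidean_space \<Rightarrow> 'v \<Rightarrow> 'v) \<Rightarrow> bool" where
  "lie_bracket br \<longleftrightarrow> bilinear br \<and> (\<forall>x. br x x = 0) \<and>
     (\<forall>x y z. br x (br y z) + br y (br z x) + br z (br x y) = 0)"

definition symmetric_lie_algebra ::
  "('v::euclidean_space \<Rightarrow> 'v \<Rightarrow> 'v) \<Rightarrow> ('v \<Rightarrow> 'v) \<Rightarrow> bool" where
  "symmetric_lie_algebra br \<tau> \<longleftrightarrow> lie_bracket br \<and>
     linear \<tau> \<and> (\<forall>x y. \<tau> (br x y) = br (\<tau> x) (\<tau> y)) \<and> (\<forall>x. \<tau> (\<tau> x) = x)"

definition fixed_part :: "('v \<Rightarrow> 'v) \<Rightarrow> 'v set" where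
  "fixed_part \<tau> = {x. \<tau> x = x}"

definition antifixed_part :: "('v::real_vector \<Rightarrow> 'v) \<Rightarrow> 'v set" where
  "antifixed_part \<tau> = {x. \<tau> x = - x}"

text \<open>The group generated by the operators \<open>exp (ad x)\<close> with \<open>x\<close> in \<open>S\<close>.\<close>

definition inner_group :: "('v::euclidean_space \<Rightarrow> 'v \<Rightarrow> 'v) \<Rightarrow> 'v set \<Rightarrow> ('v \<Rightarrow> 'v) set" where
  "inner_group br S = generate (BijGroup UNIV) ((\<lambda>x. endo_exp (br x)) ` S)"

definition compactly_causal ::
  "('v::euclidean_space \<Rightarrow> 'v \<Rightarrow> 'v) \<Rightarrow> ('v \<Rightarrow> 'v) \<Rightarrow> 'v set \<Rightarrow> bool" where
  "compactly_causal br \<tau> C \<longleftrightarrow>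
     symmetric_lie_algebra br \<tau> \<and>
     C \<subseteq> antifixed_part \<tau> \<and> closed C \<and> convex C \<and> cone C \<and>
     \<not> (\<exists>x v. v \<noteq> 0 \<and> (\<forall>t. x + t *\<^sub>R v \<in> C)) \<and>
     {x - y | x y. x \<in> C \<and> y \<in> C} = antifixed_part \<tau> \<and>
     (\<forall>\<phi>\<in>inner_group br (fixed_part \<tau>). \<phi> ` C \<subseteq> C) \<and>
     (\<forall>x \<in> (top_of_set (antifixed_part \<tau>)) interior_of C.
        semisimple_endo (br x) \<and> (\<forall>c\<in>complex_spectrum (br x). Re c = 0))"

definition euler_element :: "('v::euclidean_space \<Rightarrow> 'v \<Rightarrow> 'v) \<Rightarrow> 'v \<Rightarrow> bool" where
  "euler_element br h \<longleftrightarrow> br h \<noteq> (\<lambda>_. 0) \<and>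
     (\<exists>B. independent B \<and> span B = UNIV \<and>
        (\<forall>b\<in>B. \<exists>c\<in>{-1, 0, 1::real}. br h b = c *\<^sub>R b))"

text \<open>
  \<open>exp (\<pi> \<i> ad h)\<close> lives on the complexification; for an Euler element \<open>h\<close> it preserves the
  real form, and \<open>tau_h br h\<close> is its restriction to it.
\<close>

definition tau_h :: "('v::euclidean_space \<Rightarrow> 'v \<Rightarrow> 'v) \<Rightarrow> 'v \<Rightarrow> 'v \<Rightarrow> 'v" where
  "tau_h br h x =
     fst (endo_exp (\<lambda>w. cscale (complex_of_real pi * \<i>) (complexify (br h) w)) (x, 0))"

definition modular_compactly_causal ::
  "('v::euclidean_space \<Rightarrow> 'v \<Rightarrow> 'v) \<Rightarrow> ('v \<Rightarrow> 'v) \<Rightarrow> 'v set \<Rightarrow> 'v \<Rightarrow> bool" where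
  "modular_compactly_causal br \<tau> C h \<longleftrightarrow>
     compactly_causal br \<tau> C \<and> h \<in> fixed_part \<tau> \<and> euler_element br h \<and>
     tau_h br h ` C = uminus ` C"


section \<open>The fixed points of the modular flow\<close>

text \<open>
  A coset \<open>gH\<close> is fixed by the flow \<open>gH \<mapsto> exp (t h) gH\<close> iff \<open>exp (t Ad(g)\<^sup>-\<^sup>1 h) \<in> H\<close> for
  all \<open>t\<close>, i.e. iff \<open>Ad(g)\<^sup>-\<^sup>1 h\<close> lies in the Lie algebra \<open>fixed_part \<tau>\<close> of \<open>H\<close>.
\<close>

definition M_alpha ::
  "'g monoid \<Rightarrow> ('g, real) manifold \<Rightarrow> ('v \<Rightarrow> ('g \<Rightarrow> real) \<Rightarrow> real) \<Rightarrow> ('v \<Rightarrow> 'v) \<Rightarrow> 'g set \<Rightarrow> 'v \<Rightarrow>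
     'g set set" where
  "M_alpha G M \<iota> \<tau> H h =
     {g <#\<^bsub>G\<^esub> H | g. g \<in> carrier G \<and> inv_into UNIV (Ad G M \<iota> g) h \<in> fixed_part \<tau>}"

definition G_h ::
  "'g monoid \<Rightarrow> ('g, real) manifold \<Rightarrow> ('v \<Rightarrow> ('g \<Rightarrow> real) \<Rightarrow> real) \<Rightarrow> 'v \<Rightarrow> 'g set" where
  "G_h G M \<iota> h = {g \<in> carrier G. Ad G M \<iota> g h = h}"

definition adjoint_orbit ::
  "'g monoid \<Rightarrow> ('g, real) manifold \<Rightarrow> ('v \<Rightarrow> ('g \<Rightarrow> real) \<Rightarrow> real) \<Rightarrow> 'v \<Rightarrow> 'v set" where
  "adjoint_orbit G M \<iota> h = {Ad G M \<iota> g h | g. g \<in> carrier G}"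

end

theory Submission
  imports Defs
begin

text \<open>
  Both sides of the correspondence are the same set of double cosets. Put
  \<open>X = {g \<in> G. Ad(g)\<^sup>-\<^sup>1 h \<in> \<hh>}\<close>, where \<open>\<hh>\<close> is the fixed part of \<open>\<tau>\<close>. The \<open>G\<^sup>h\<close>-orbits in
  \<open>M\<^sup>\<alpha>\<close> are the images of the elements of \<open>X\<close> in \<open>G\<^sup>h \ G / H\<close>. On the other side every element of
  \<open>\<O>\<^sub>h \<inter> \<hh>\<close> is \<open>Ad(g)\<^sup>-\<^sup>1 h\<close> for some \<open>g \<in> X\<close>, two elements \<open>a, b\<close> give the same point iff
  \<open>a b\<^sup>-\<^sup>1\<close> fixes \<open>h\<close>, and acting by \<open>y \<in> H\<close> on the point replaces \<open>g\<close> by \<open>g y\<^sup>-\<^sup>1\<close>. Hence the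
  \<open>Ad(H)\<close>-orbits are again the images of \<open>X\<close> in \<open>G\<^sup>h \ G / H\<close>. This is a statement about
  group actions, proved as \<open>double_coset_orbits\<close>.

  What remains is that \<open>Ad\<close> is a group action at all (\<open>Ad_group_action\<close>). Tangent vectors are
  derivations of the algebra of smooth functions, so this is the functoriality of the differential
  (\<open>differential_tangent_space\<close>, \<open>differential_compose\<close>) applied to conjugations, once these
  are known to be smooth. Smoothness of a conjugation is extracted from that of the multiplication
  \<open>M \<times> M \<rightarrow> M\<close> by restricting it to a slice \<open>{p} \<times> M\<close> (\<open>smooth_map_slice\<close>): in product charts
  the slice is an affine embedding that sends coordinate lines to coordinate lines, and iterated
  partial derivatives simply restrict along such embeddings (\<open>Ck_compose_embedding\<close>).
\<close>

section \<open>Calculus of iterated partial derivatives\<close>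

lemma Ck_SucI:
  assumes "continuous_on V f"
    and "\<And>i x. i < n \<Longrightarrow> x \<in> V \<Longrightarrow> (\<lambda>t. f (x(i := t))) field_differentiable at (x i)"
    and "\<And>i. i < n \<Longrightarrow> Ck n k V (\<lambda>x. deriv (\<lambda>t. f (x(i := t))) (x i))"
  shows "Ck n (Suc k) V f"
  unfolding Ck.simps using assms by blast

lemma Ck_SucD:
  assumes "Ck n (Suc k) V f"
  shows "continuous_on V f"
    and "i < n \<Longrightarrow> x \<in> V \<Longrightarrow> (\<lambda>t. f (x(i := t))) field_differentiable at (x i)"
    and "i < n \<Longrightarrow> Ck n k V (\<lambda>x. deriv (\<lambda>t. f (x(i := t))) (x i))"
  using assms unfolding Ck.simps by blast+

lemma Ck_Suc_imp: "Ck n (Suc k) V f \<Longrightarrow> Ck n k V f"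
proof (induction k arbitrary: f)
  case (Suc k)
  then show ?case by (blast intro: Ck_SucI dest: Ck_SucD)
qed simp

lemma continuous_on_coordinate_update:
  "continuous_on UNIV (\<lambda>t::'k::topological_space. x(i := t))"
proof (intro continuous_on_coordinatewise_then_product)
  fix j show "continuous_on UNIV (\<lambda>t. (x(i := t)) j)"
    by (cases "j = i") simp_all
qed

text \<open>
  Smoothness is only tested on subsets of \<open>coord_space n\<close>, which are not open in the whole sequence
  space. Openness relative to \<open>coord_space n\<close> is enough to vary one of the first \<open>n\<close> coordinates,
  which is all that partial derivatives ask for.
\<close>

lemma eventually_coordinate_update:
  assumes "openin (top_of_set (coord_space n)) V" "x \<in> V" "i < n"
  shows "\<forall>\<^sub>F t in nhds (x i). x(i := t) \<in> V"
proof -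
  obtain S where S: "open S" "V = coord_space n \<inter> S"
    using assms(1) unfolding openin_open by blast
  have "open ((\<lambda>t. x(i := t)) -` S)"
    by (rule open_vimage[OF S(1) continuous_on_coordinate_update])
  moreover have "x i \<in> (\<lambda>t. x(i := t)) -` S"
    using assms(2) S by simp
  ultimately have "\<forall>\<^sub>F t in nhds (x i). x(i := t) \<in> S"
    unfolding eventually_nhds by blast
  then show ?thesis
  proof eventually_elim
    case (elim t)
    have "x(i := t) \<in> coord_space n"
      using assms(2,3) S(2) by (simp add: coord_space_def)
    then show ?case
      using elim S(2) by blast
  qed
qed

text \<open>
  The partial derivatives at a point see a function on a whole piece of a coordinate line, so
  the values on \<open>V\<close> determine them only because \<open>V\<close> is open in \<open>coord_space n\<close>.
\<close>

lemma Ck_cong: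
  assumes "openin (top_of_set (coord_space n)) V" "\<And>x. x \<in> V \<Longrightarrow> f x = g x" "Ck n k V f"
  shows "Ck n k V g"
  using assms(2,3)
proof (induction k arbitrary: f g)
  case 0
  then show ?case
    using continuous_on_eq[of V f g] by simp
next
  case (Suc k)
  have ev: "\<forall>\<^sub>F t in nhds (x i). f (x(i := t)) = g (x(i := t))" if "i < n" "x \<in> V" for x i
    using eventually_coordinate_update[OF assms(1) that(2,1)]
    by eventually_elim (rule Suc.prems(1))
  show ?case
  proof (rule Ck_SucI)
    show "continuous_on V g"
      by (rule continuous_on_eq[OF Ck_SucD(1)[OF Suc.prems(2)] Suc.prems(1)])
  next
    fix i x assume ix: "i < n" "x \<in> V"
    obtain D where "((\<lambda>t. f (x(i := t))) has_field_derivative D) (at (x i))"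
      using Ck_SucD(2)[OF Suc.prems(2) ix] unfolding field_differentiable_def by blast
    then have "((\<lambda>t. g (x(i := t))) has_field_derivative D) (at (x i))"
      using DERIV_cong_ev[OF refl ev[OF ix] refl] by blast
    then show "(\<lambda>t. g (x(i := t))) field_differentiable at (x i)"
      unfolding field_differentiable_def by blast
  next
    fix i assume i: "i < n"
    show "Ck n k V (\<lambda>x. deriv (\<lambda>t. g (x(i := t))) (x i))"
    proof (rule Suc.IH[OF _ Ck_SucD(3)[OF Suc.prems(2) i]])
      fix x assume "x \<in> V"
      from ev[OF i this] show "deriv (\<lambda>t. f (x(i := t))) (x i) = deriv (\<lambda>t. g (x(i := t))) (x i)"
        by (rule deriv_cong_ev) (rule refl)
    qed
  qed
qed

lemma Ck_const: "Ck n k V (\<lambda>_. c)"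
  by (induction k arbitrary: c) simp_all

lemma Ck_add:
  assumes "openin (top_of_set (coord_space n)) V" "Ck n k V f" "Ck n k V g"
  shows "Ck n k V (\<lambda>x. f x + g x)"
  using assms(2,3)
proof (induction k arbitrary: f g)
  case 0
  then show ?case by (simp add: continuous_on_add)
next
  case (Suc k)
  note f = Ck_SucD[OF Suc.prems(1)] and g = Ck_SucD[OF Suc.prems(2)]
  show ?case
  proof (rule Ck_SucI)
    fix i assume i: "i < n"
    show "Ck n k V (\<lambda>x. deriv (\<lambda>t. f (x(i := t)) + g (x(i := t))) (x i))"
    proof (rule Ck_cong[OF assms(1) _ Suc.IH[OF f(3)[OF i] g(3)[OF i]]])
      fix x assume "x \<in> V"
      from deriv_add[OF f(2)[OF i this] g(2)[OF i this]]
      show "deriv (\<lambda>t. f (x(i := t))) (x i) + deriv (\<lambda>t. g (x(i := t))) (x i)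
          = deriv (\<lambda>t. f (x(i := t)) + g (x(i := t))) (x i)"
        by (rule sym)
    qed
  next
    fix i x assume ix: "i < n" "x \<in> V"
    show "(\<lambda>t. f (x(i := t)) + g (x(i := t))) field_differentiable at (x i)"
      by (rule field_differentiable_add[OF f(2)[OF ix] g(2)[OF ix]])
  qed (rule continuous_on_add[OF f(1) g(1)])
qed

lemma Ck_mult:
  assumes "openin (top_of_set (coord_space n)) V" "Ck n k V f" "Ck n k V g"
  shows "Ck n k V (\<lambda>x. f x * g x)"
  using assms(2,3)
proof (induction k arbitrary: f g)
  case 0
  then show ?case by (simp add: continuous_on_mult)
next
  case (Suc k)
  note f = Ck_SucD[OF Suc.prems(1)] and g = Ck_SucD[OF Suc.prems(2)]
  show ?case
  proof (rule Ck_SucI)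
    fix i assume i: "i < n"
    have "Ck n k V (\<lambda>x. f x * deriv (\<lambda>t. g (x(i := t))) (x i)
                        + deriv (\<lambda>t. f (x(i := t))) (x i) * g x)"
      by (rule Ck_add[OF assms(1) Suc.IH[OF Ck_Suc_imp[OF Suc.prems(1)] g(3)[OF i]]
              Suc.IH[OF f(3)[OF i] Ck_Suc_imp[OF Suc.prems(2)]]])
    then show "Ck n k V (\<lambda>x. deriv (\<lambda>t. f (x(i := t)) * g (x(i := t))) (x i))"
    proof (rule Ck_cong[OF assms(1), rotated])
      fix x assume x: "x \<in> V"
      show "f x * deriv (\<lambda>t. g (x(i := t))) (x i) + deriv (\<lambda>t. f (x(i := t))) (x i) * g x
          = deriv (\<lambda>t. f (x(i := t)) * g (x(i := t))) (x i)"
        using deriv_mult[OF f(2)[OF i x] g(2)[OF i x]] by (simp only: fun_upd_triv)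
    qed
  next
    fix i x assume ix: "i < n" "x \<in> V"
    show "(\<lambda>t. f (x(i := t)) * g (x(i := t))) field_differentiable at (x i)"
      by (rule field_differentiable_mult[OF f(2)[OF ix] g(2)[OF ix]])
  qed (rule continuous_on_mult[OF f(1) g(1)])
qed

text \<open>
  The map \<open>e\<close> carries the \<open>i\<close>-th coordinate line through \<open>x\<close> to the \<open>s i\<close>-th coordinate line
  through \<open>e x\<close>, with the same parameter. The \<open>i\<close>-th partial derivative of \<open>f \<circ> e\<close> is therefore
  the \<open>s i\<close>-th partial derivative of \<open>f\<close>, composed with \<open>e\<close>, to which the induction hypothesis
  applies again.
\<close>

lemma Ck_compose_embedding:
  assumes "continuous_on V e" "e ` V \<subseteq> V'"
    and "\<And>x i t. i < n \<Longrightarrow> e (x(i := t)) = (e x)(s i := t)" "\<And>i. i < n \<Longrightarrow> s i < m"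
    and "Ck m k V' f"
  shows "Ck n k V (\<lambda>x. f (e x))"
  using assms(5)
proof (induction k arbitrary: f)
  case 0
  then show ?case
    using continuous_on_compose2[OF _ assms(1,2)] by simp
next
  case (Suc k)
  \<comment> \<open>Updating \<open>x\<close> at \<open>i\<close> by its own value does nothing, so the value of \<open>e x\<close> at \<open>s i\<close> is \<open>x i\<close>.\<close>
  have e: "e x (s i) = x i" if "i < n" for x i
    using assms(3)[OF that, of x "x i"] by (metis fun_upd_same fun_upd_triv)
  show ?case
  proof (rule Ck_SucI)
    show "continuous_on V (\<lambda>x. f (e x))"
      by (rule continuous_on_compose2[OF Ck_SucD(1)[OF Suc.prems] assms(1,2)])
  next
    fix i x assume i: "i < n" and "x \<in> V"
    then have "e x \<in> V'"
      using assms(2) by blast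
    from Ck_SucD(2)[OF Suc.prems assms(4)[OF i] this]
    show "(\<lambda>t. f (e (x(i := t)))) field_differentiable at (x i)"
      by (simp only: assms(3)[OF i] e[OF i])
  next
    fix i assume i: "i < n"
    from Suc.IH[OF Ck_SucD(3)[OF Suc.prems assms(4)[OF i]]]
    show "Ck n k V (\<lambda>x. deriv (\<lambda>t. f (e (x(i := t)))) (x i))"
      by (simp only: assms(3)[OF i] e[OF i])
  qed
qed

section \<open>Smooth maps\<close>

lemma chart_properties:
  assumes "smooth_manifold M" "(U, \<phi>) \<in> charts M"
  shows chart_image_coord_space: "\<phi> ` U \<subseteq> coord_space (mdim M)"
    and chart_inj_on: "inj_on \<phi> U"
    and chart_image_open: "openin (mtop M) W \<Longrightarrow>
           openin (top_of_set (coord_space (mdim M))) (\<phi> ` (U \<inter> W))"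
proof -
  have U: "openin (mtop M) U"
    and im: "openin (top_of_set (coord_space (mdim M))) (\<phi> ` U)"
    and hom: "homeomorphic_map (subtopology (mtop M) U) (top_of_set (\<phi> ` U)) \<phi>"
    using assms unfolding smooth_manifold_def by blast+
  show "\<phi> ` U \<subseteq> coord_space (mdim M)"
    using openin_subset[OF im] by simp
  show "inj_on \<phi> U"
    using hom openin_subset[OF U]
    by (simp add: homeomorphic_eq_everything_map inf.absorb2)
  assume "openin (mtop M) W"
  then have "openin (subtopology (mtop M) U) (U \<inter> W)"
    by (rule openin_subtopology_Int2)
  then have "openin (top_of_set (\<phi> ` U)) (\<phi> ` (U \<inter> W))"
    using homeomorphic_imp_open_map[OF hom] by (simp add: open_map_def)
  then show "openin (top_of_set (coord_space (mdim M))) (\<phi> ` (U \<inter> W))"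
    using im openin_trans by blast
qed

text \<open>
  Outside its chart image a function read in a chart has arbitrary values, because \<open>inv_into\<close>
  does. Only the values over \<open>W\<close> matter, by openness of the image of \<open>W\<close> in the chart.
\<close>

lemma smooth_on_cong:
  assumes "smooth_manifold M" "\<And>x. x \<in> W \<Longrightarrow> f x = g x" "smooth_on M W f"
  shows "smooth_on M W g"
  unfolding smooth_on_def
proof (intro conjI ballI, safe)
  show W: "openin (mtop M) W"
    using assms(3) by (simp add: smooth_on_def)
  fix U \<phi> assume U: "(U, \<phi>) \<in> charts M"
  show "Cinf (mdim M) (\<phi> ` (U \<inter> W)) (\<lambda>x. g (inv_into U \<phi> x))"
    unfolding Cinf_def
  proof (intro allI, rule Ck_cong[OF chart_image_open[OF assms(1) U W]])
    fix k show "Ck (mdim M) k (\<phi> ` (U \<inter> W)) (\<lambda>x. f (inv_into U \<phi> x))"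
      using assms(3) U by (auto simp: smooth_on_def Cinf_def)
  next
    fix x assume "x \<in> \<phi> ` (U \<inter> W)"
    then show "f (inv_into U \<phi> x) = g (inv_into U \<phi> x)"
      using chart_inj_on[OF assms(1) U] by (auto intro: assms(2))
  qed
qed

lemma smooth_on_add:
  assumes "smooth_manifold M" "smooth_on M W f" "smooth_on M W g"
  shows "smooth_on M W (\<lambda>x. f x + g x)"
  using assms chart_image_open[OF assms(1), of _ _ W] unfolding smooth_on_def Cinf_def
  by (fastforce intro!: Ck_add)

lemma smooth_on_mult:
  assumes "smooth_manifold M" "smooth_on M W f" "smooth_on M W g"
  shows "smooth_on M W (\<lambda>x. f x * g x)"
  using assms chart_image_open[OF assms(1), of _ _ W] unfolding smooth_on_def Cinf_def
  by (fastforce intro!: Ck_mult)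

lemma smooth_on_const: "openin (mtop M) W \<Longrightarrow> smooth_on M W (\<lambda>_. c)"
  by (auto simp: smooth_on_def Cinf_def Ck_const)

lemma smooth_map_compose:
  assumes "smooth_map M N F" "smooth_map N P G"
  shows "smooth_map M P (G \<circ> F)"
  unfolding smooth_map_def
proof (intro conjI allI impI)
  have F: "continuous_map (mtop M) (mtop N) F"
    using assms by (simp add: smooth_map_def)
  then show "continuous_map (mtop M) (mtop P) (G \<circ> F)"
    using assms continuous_map_compose by (fastforce simp: smooth_map_def)
  fix V f assume "smooth_on P V f"
  then have "smooth_on M {x \<in> topspace (mtop M). F x \<in> {y \<in> topspace (mtop N). G y \<in> V}}
               ((f \<circ> G) \<circ> F)"
    using assms unfolding smooth_map_def by blast
  moreover have "{x \<in> topspace (mtop M). F x \<in> {y \<in> topspace (mtop N). G y \<in> V}}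
      = {x \<in> topspace (mtop M). (G \<circ> F) x \<in> V}"
    using continuous_map_funspace[OF F] by auto
  ultimately show "smooth_on M {x \<in> topspace (mtop M). (G \<circ> F) x \<in> V} (f \<circ> (G \<circ> F))"
    by (simp add: comp_assoc)
qed

lemma smooth_map_cong:
  assumes "smooth_manifold M" "\<And>x. x \<in> topspace (mtop M) \<Longrightarrow> F x = F' x" "smooth_map M N F"
  shows "smooth_map M N F'"
  unfolding smooth_map_def
proof (intro conjI allI impI)
  show "continuous_map (mtop M) (mtop N) F'"
    using assms(3) by (intro continuous_map_eq[OF _ assms(2)]) (simp_all add: smooth_map_def)
  fix V f assume "smooth_on N V f"
  then have "smooth_on M {x \<in> topspace (mtop M). F x \<in> V} (f \<circ> F)"
    using assms(3) by (simp add: smooth_map_def)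
  moreover have "{x \<in> topspace (mtop M). F x \<in> V} = {x \<in> topspace (mtop M). F' x \<in> V}"
    using assms(2) by auto
  ultimately show "smooth_on M {x \<in> topspace (mtop M). F' x \<in> V} (f \<circ> F')"
    using assms(2) by (intro smooth_on_cong[OF assms(1), of _ "f \<circ> F" "f \<circ> F'"]) auto
qed

lemma manifold_chart_at:
  assumes "smooth_manifold M" "p \<in> topspace (mtop M)"
  obtains U \<phi> where "(U, \<phi>) \<in> charts M" "p \<in> U"
  using assms unfolding smooth_manifold_def by blast

lemma product_chart:
  assumes "(U, \<phi>) \<in> charts M" "(V, \<psi>) \<in> charts N"
  shows "(U \<times> V, \<lambda>(x, y) i. if i < mdim M then \<phi> x i else \<psi> y (i - mdim M))
           \<in> charts (product_manifold M N)"
  using assms by (auto simp: product_manifold_def)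

text \<open>
  A product chart is injective because a chart image has no coordinates beyond the dimension: the
  coordinates of index below \<open>mdim M\<close> determine the first component, the others the second.
\<close>

lemma inv_into_product_chart:
  assumes "smooth_manifold M" "smooth_manifold N" "(U, \<phi>) \<in> charts M" "(V, \<psi>) \<in> charts N"
    and "p \<in> U" "q \<in> V"
  shows "inv_into (U \<times> V) (\<lambda>(x, y) i. if i < mdim M then \<phi> x i else \<psi> y (i - mdim M))
           (\<lambda>i. if i < mdim M then \<phi> p i else \<psi> q (i - mdim M)) = (p, q)"
proof -
  let ?\<Phi> = "\<lambda>(x, y) i. if i < mdim M then \<phi> x i else \<psi> y (i - mdim M)"
  have "inj_on ?\<Phi> (U \<times> V)"
  proof (intro inj_onI, clarify)
    fix x y x' y' assume xy: "x \<in> U" "x' \<in> U" "y \<in> V" "y' \<in> V"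
      and "(\<lambda>i. if i < mdim M then \<phi> x i else \<psi> y (i - mdim M)) =
           (\<lambda>i. if i < mdim M then \<phi> x' i else \<psi> y' (i - mdim M))"
    then have eq: "(if i < mdim M then \<phi> x i else \<psi> y (i - mdim M)) =
                   (if i < mdim M then \<phi> x' i else \<psi> y' (i - mdim M))" for i
      by meson
    have "\<phi> x = \<phi> x'"
    proof
      fix i show "\<phi> x i = \<phi> x' i"
        using eq[of i] xy chart_image_coord_space[OF assms(1,3)]
        by (cases "i < mdim M") (auto simp: coord_space_def image_subset_iff)
    qed
    moreover have "\<psi> y = \<psi> y'"
    proof
      fix i show "\<psi> y i = \<psi> y' i"
        using eq[of "mdim M + i"] by simp
    qed
    ultimately show "x = x' \<and> y = y'"
      using xy chart_inj_on[OF assms(1,3)] chart_inj_on[OF assms(2,4)]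
      by (auto simp: inj_on_def)
  qed
  from inv_into_f_f[OF this, of "(p, q)"] show ?thesis
    using assms by simp
qed

text \<open>
  In the product of a chart around \<open>p\<close> with a chart of \<open>N\<close>, the slice is the embedding that puts the
  fixed coordinates of \<open>p\<close> in front and shifts the coordinates of \<open>y\<close> by \<open>mdim M\<close>.
\<close>

lemma smooth_map_slice:
  assumes M: "smooth_manifold M" and N: "smooth_manifold N" and p: "p \<in> topspace (mtop M)"
  shows "smooth_map N (product_manifold M N) (\<lambda>y. (p, y))"
  unfolding smooth_map_def
proof (intro conjI allI impI)
  show cont: "continuous_map (mtop N) (mtop (product_manifold M N)) (\<lambda>y. (p, y))"
    using p by (simp add: product_manifold_def continuous_map_pairedI)
  fix W f assume f: "smooth_on (product_manifold M N) W f"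
  let ?W = "{y \<in> topspace (mtop N). (p, y) \<in> W}"
  obtain U \<phi> where U: "(U, \<phi>) \<in> charts M" "p \<in> U"
    using manifold_chart_at[OF M p] .
  show "smooth_on N ?W (f \<circ> (\<lambda>y. (p, y)))"
    unfolding smooth_on_def
  proof (intro conjI ballI, safe)
    have "openin (mtop (product_manifold M N)) W"
      using f by (simp add: smooth_on_def)
    then show W: "openin (mtop N) ?W"
      by (rule openin_continuous_map_preimage[OF cont])
    fix V \<psi> assume V: "(V, \<psi>) \<in> charts N"
    let ?\<Phi> = "\<lambda>(x, y) i. if i < mdim M then \<phi> x i else \<psi> y (i - mdim M)"
    let ?e = "\<lambda>y i. if i < mdim M then \<phi> p i else y (i - mdim M)"
    have "Ck (mdim N) k (\<psi> ` (V \<inter> ?W)) (\<lambda>y. (f \<circ> (\<lambda>y. (p, y))) (inv_into V \<psi> y))" for k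
    proof (rule Ck_cong[OF chart_image_open[OF N V W]])
      have base: "Ck (mdim M + mdim N) k (?\<Phi> ` ((U \<times> V) \<inter> W)) (\<lambda>z. f (inv_into (U \<times> V) ?\<Phi> z))"
        using f product_chart[OF U(1) V]
        by (fastforce simp: smooth_on_def Cinf_def product_manifold_def)
      have im: "?e ` \<psi> ` (V \<inter> ?W) \<subseteq> ?\<Phi> ` ((U \<times> V) \<inter> W)"
        using U by (force simp: image_iff)
      have cont_e: "continuous_on (\<psi> ` (V \<inter> ?W)) ?e"
      proof (intro continuous_on_coordinatewise_then_product)
        fix i show "continuous_on (\<psi> ` (V \<inter> ?W)) (\<lambda>y. ?e y i)"
          by (cases "i < mdim M")
             (auto intro: continuous_on_subset[OF continuous_on_product_coordinates])
      qed
      have upd: "?e (y(i := t)) = (?e y)(mdim M + i := t)" if "i < mdim N" for y i t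
        by (intro ext) auto
      show "Ck (mdim N) k (\<psi> ` (V \<inter> ?W)) (\<lambda>y. f (inv_into (U \<times> V) ?\<Phi> (?e y)))"
        by (rule Ck_compose_embedding[OF cont_e im upd _ base]) simp_all
    next
      fix y assume "y \<in> \<psi> ` (V \<inter> ?W)"
      then show "f (inv_into (U \<times> V) ?\<Phi> (?e y)) = (f \<circ> (\<lambda>y. (p, y))) (inv_into V \<psi> y)"
        using inv_into_product_chart[OF M N U(1) V U(2)] chart_inj_on[OF N V] by auto
    qed
    then show "Cinf (mdim N) (\<psi> ` (V \<inter> ?W)) (\<lambda>y. (f \<circ> (\<lambda>y. (p, y))) (inv_into V \<psi> y))"
      by (simp add: Cinf_def)
  qed
qed

section \<open>Differentials\<close>

text \<open>
  The extension by zero keeps a pulled back function in \<open>smooth_functions M\<close>, whose members vanish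
  outside the manifold.
\<close>

definition pullback :: "('p, real) manifold \<Rightarrow> ('p \<Rightarrow> 'q) \<Rightarrow> ('q \<Rightarrow> real) \<Rightarrow> 'p \<Rightarrow> real" where
  "pullback M F f = (\<lambda>x. if x \<in> topspace (mtop M) then f (F x) else 0)"

lemma differential_pullback:
  "differential M N F D f = (if f \<in> smooth_functions N then D (pullback M F f) else 0)"
  by (simp add: differential_def pullback_def fun_eq_iff)

lemma pullback_smooth_functions:
  assumes "smooth_manifold M" "smooth_map M N F" "f \<in> smooth_functions N"
  shows "pullback M F f \<in> smooth_functions M"
proof -
  have "smooth_on M {x \<in> topspace (mtop M). F x \<in> topspace (mtop N)} (f \<circ> F)"
    using assms by (simp add: smooth_map_def smooth_functions_def)
  moreover have "{x \<in> topspace (mtop M). F x \<in> topspace (mtop N)} = topspace (mtop M)"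
    using assms(2) continuous_map_funspace by (fastforce simp: smooth_map_def)
  ultimately have "smooth_on M (topspace (mtop M)) (f \<circ> F)"
    by simp
  then have "smooth_on M (topspace (mtop M)) (pullback M F f)"
    by (rule smooth_on_cong[OF assms(1), rotated]) (simp add: pullback_def)
  then show ?thesis
    by (simp add: smooth_functions_def pullback_def)
qed

lemma smooth_functions_add:
  assumes "smooth_manifold M" "f \<in> smooth_functions M" "g \<in> smooth_functions M"
  shows "(\<lambda>x. f x + g x) \<in> smooth_functions M"
  using assms by (simp add: smooth_functions_def smooth_on_add)

lemma smooth_functions_mult:
  assumes "smooth_manifold M" "f \<in> smooth_functions M" "g \<in> smooth_functions M"
  shows "(\<lambda>x. f x * g x) \<in> smooth_functions M"
  using assms by (simp add: smooth_functions_def smooth_on_mult)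

lemma smooth_functions_scale:
  assumes "smooth_manifold M" "f \<in> smooth_functions M"
  shows "(\<lambda>x. c * f x) \<in> smooth_functions M"
  using assms by (simp add: smooth_functions_def smooth_on_mult smooth_on_const)

text \<open>
  Pulling back is an algebra homomorphism, and evaluation at \<open>p\<close> of a pullback is evaluation at
  \<open>F p\<close>; so it turns derivations at \<open>p\<close> into derivations at \<open>F p\<close>. The smooth functions on \<open>N\<close>
  must be closed under the algebra operations, as a differential vanishes by convention on all
  other functions.
\<close>

lemma differential_tangent_space:
  assumes "smooth_manifold M" "smooth_manifold N" "smooth_map M N F"
    and "p \<in> topspace (mtop M)" "D \<in> tangent_space M p"
  shows "differential M N F D \<in> tangent_space N (F p)"
proof -
  have add: "pullback M F (\<lambda>x. f x + g x) = (\<lambda>x. pullback M F f x + pullback M F g x)"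
    and mult: "pullback M F (\<lambda>x. f x * g x) = (\<lambda>x. pullback M F f x * pullback M F g x)"
    and scale: "pullback M F (\<lambda>x. c * f x) = (\<lambda>x. c * pullback M F f x)"
    and at_p: "pullback M F f p = f (F p)" for f g c
    using assms(4) by (auto simp: pullback_def)
  have D: "differential M N F D f = D (pullback M F f)" if "f \<in> smooth_functions N" for f
    using that by (simp add: differential_pullback)
  show ?thesis
    unfolding tangent_space_def
  proof (intro CollectI conjI ballI allI impI)
    fix f g :: "'b \<Rightarrow> real" and c
    assume f: "f \<in> smooth_functions N"
    note f' = pullback_smooth_functions[OF assms(1,3) f]
    show "differential M N F D (\<lambda>x. c * f x) = c * differential M N F D f"
      using assms(5) f f' smooth_functions_scale[OF assms(2) f]
      unfolding tangent_space_def by (simp only: D scale) blast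
    assume g: "g \<in> smooth_functions N"
    note g' = pullback_smooth_functions[OF assms(1,3) g]
    show "differential M N F D (\<lambda>x. f x + g x) = differential M N F D f + differential M N F D g"
      using assms(5) f f' g g' smooth_functions_add[OF assms(2) f g]
      unfolding tangent_space_def by (simp only: D add) blast
    have "D (\<lambda>x. pullback M F f x * pullback M F g x)
        = pullback M F f p * D (pullback M F g) + pullback M F g p * D (pullback M F f)"
      using assms(5) f' g' unfolding tangent_space_def by blast
    then show "differential M N F D (\<lambda>x. f x * g x)
        = f (F p) * differential M N F D g + g (F p) * differential M N F D f"
      using f g smooth_functions_mult[OF assms(2) f g] by (simp only: D mult at_p)
  qed (simp add: differential_pullback)
qed

lemma differential_compose:
  assumes "smooth_manifold N" "smooth_map M N F" "smooth_map N P G"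
  shows "differential N P G (differential M N F D) = differential M P (G \<circ> F) D"
proof -
  have "pullback M F (pullback N G f) = pullback M (G \<circ> F) f" for f
    using assms(2) continuous_map_funspace by (fastforce simp: smooth_map_def pullback_def)
  then show ?thesis
    by (intro ext) (simp add: differential_pullback pullback_smooth_functions[OF assms(1,3)])
qed

lemma differential_cong:
  assumes "\<And>x. x \<in> topspace (mtop M) \<Longrightarrow> F x = F' x"
  shows "differential M N F = differential M N F'"
proof -
  have "pullback M F = pullback M F'"
    using assms by (intro ext) (simp add: pullback_def)
  then show ?thesis
    by (intro ext) (simp add: differential_pullback)
qed

lemma differential_ident:
  assumes "D \<in> tangent_space M p"
  shows "differential M M (\<lambda>x. x) D = D"
proof
  fix f
  have "pullback M (\<lambda>x. x) f = f" if "f \<in> smooth_functions M"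
    using that by (auto simp: pullback_def smooth_functions_def)
  then show "differential M M (\<lambda>x. x) D f = D f"
    using assms by (simp add: differential_pullback tangent_space_def)
qed

section \<open>The adjoint representation\<close>

text \<open>
  Since \<open>g y g\<^sup>-\<^sup>1 = g (g y\<^sup>-\<^sup>1)\<^sup>-\<^sup>1\<close>, a conjugation is built from two left translations and two
  inversions, and a left translation is the multiplication restricted to a slice.
\<close>

lemma smooth_map_conjugation:
  assumes "lie_group G M" "g \<in> carrier G"
  shows "smooth_map M M (\<lambda>y. g \<otimes>\<^bsub>G\<^esub> y \<otimes>\<^bsub>G\<^esub> inv\<^bsub>G\<^esub> g)"
proof -
  interpret group G using assms(1) by (simp add: lie_group_def)
  have M: "smooth_manifold M" and top: "topspace (mtop M) = carrier G"
    and mult: "smooth_map (product_manifold M M) M (\<lambda>(x, y). x \<otimes>\<^bsub>G\<^esub> y)"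
    using assms(1) by (auto simp: lie_group_def)
  have left: "smooth_map M M (\<lambda>y. g \<otimes>\<^bsub>G\<^esub> y)"
    using smooth_map_compose[OF smooth_map_slice[OF M M] mult, of g] assms(2) top
    by (simp add: comp_def)
  have inverse: "smooth_map M M (\<lambda>y. inv\<^bsub>G\<^esub> y)"
    using assms(1) by (simp add: lie_group_def)
  have "smooth_map M M (\<lambda>y. g \<otimes>\<^bsub>G\<^esub> inv\<^bsub>G\<^esub> (g \<otimes>\<^bsub>G\<^esub> inv\<^bsub>G\<^esub> y))"
    using smooth_map_compose[OF smooth_map_compose[OF inverse left]
        smooth_map_compose[OF inverse left]]
    by (simp add: comp_def)
  then show ?thesis
    by (rule smooth_map_cong[OF M, rotated])
       (use assms(2) top in \<open>simp add: inv_mult_group m_assoc\<close>)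
qed

text \<open>
  A conjugation fixes the identity, so its differential maps the tangent space at the identity to
  itself. This is the range of \<open>\<iota>\<close>, and there \<open>inv_into UNIV \<iota>\<close> is a genuine inverse.
\<close>

lemma identification_Ad:
  assumes "lie_group G M" "lie_algebra_identification br G M \<iota>" "g \<in> carrier G"
  shows "\<iota> (Ad G M \<iota> g x) = differential M M (\<lambda>y. g \<otimes>\<^bsub>G\<^esub> y \<otimes>\<^bsub>G\<^esub> inv\<^bsub>G\<^esub> g) (\<iota> x)"
proof -
  interpret group G using assms(1) by (simp add: lie_group_def)
  have M: "smooth_manifold M" and top: "topspace (mtop M) = carrier G"
    using assms(1) by (auto simp: lie_group_def)
  have range: "range \<iota> = tangent_space M \<one>\<^bsub>G\<^esub>"
    using assms(2) by (simp add: lie_algebra_identification_def bij_betw_def)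
  have "differential M M (\<lambda>y. g \<otimes>\<^bsub>G\<^esub> y \<otimes>\<^bsub>G\<^esub> inv\<^bsub>G\<^esub> g) (\<iota> x)
          \<in> tangent_space M (g \<otimes>\<^bsub>G\<^esub> \<one>\<^bsub>G\<^esub> \<otimes>\<^bsub>G\<^esub> inv\<^bsub>G\<^esub> g)"
    using range top
    by (intro differential_tangent_space M smooth_map_conjugation[OF assms(1,3)]) auto
  then show ?thesis
    using assms(3) range by (simp add: Ad_def f_inv_into_f)
qed

lemma Ad_group_action:
  assumes G: "lie_group G M" and \<iota>: "lie_algebra_identification br G M \<iota>"
  shows "group_action G UNIV (Ad G M \<iota>)"
proof -
  interpret group G using G by (simp add: lie_group_def)
  have M: "smooth_manifold M" and top: "topspace (mtop M) = carrier G"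
    using G by (auto simp: lie_group_def)
  have inj: "inj \<iota>" and range: "range \<iota> = tangent_space M \<one>\<^bsub>G\<^esub>"
    using \<iota> by (auto simp: lie_algebra_identification_def bij_betw_def)
  have mult: "Ad G M \<iota> (a \<otimes>\<^bsub>G\<^esub> b) x = Ad G M \<iota> a (Ad G M \<iota> b x)"
    if a: "a \<in> carrier G" and b: "b \<in> carrier G" for a b x
  proof (rule injD[OF inj])
    let ?c = "\<lambda>g y. g \<otimes>\<^bsub>G\<^esub> y \<otimes>\<^bsub>G\<^esub> inv\<^bsub>G\<^esub> g"
    have "\<iota> (Ad G M \<iota> a (Ad G M \<iota> b x)) = differential M M (?c a \<circ> ?c b) (\<iota> x)"
      by (simp add: identification_Ad[OF G \<iota>] a b
          differential_compose[OF M smooth_map_conjugation[OF G] smooth_map_conjugation[OF G]])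
    also have "\<dots> = differential M M (?c (a \<otimes>\<^bsub>G\<^esub> b)) (\<iota> x)"
      using a b top by (intro fun_cong[OF differential_cong]) (simp add: m_assoc inv_mult_group)
    also have "\<dots> = \<iota> (Ad G M \<iota> (a \<otimes>\<^bsub>G\<^esub> b) x)"
      using a b by (simp add: identification_Ad[OF G \<iota>])
    finally show "\<iota> (Ad G M \<iota> (a \<otimes>\<^bsub>G\<^esub> b) x) = \<iota> (Ad G M \<iota> a (Ad G M \<iota> b x))" ..
  qed
  have one: "Ad G M \<iota> \<one>\<^bsub>G\<^esub> x = x" for x
  proof (rule injD[OF inj])
    have "\<iota> (Ad G M \<iota> \<one>\<^bsub>G\<^esub> x) = differential M M (\<lambda>y. y) (\<iota> x)"
      using top by (subst identification_Ad[OF G \<iota>])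
        (auto intro!: fun_cong[OF differential_cong])
    also have "\<dots> = \<iota> x"
      using range by (intro differential_ident) auto
    finally show "\<iota> (Ad G M \<iota> \<one>\<^bsub>G\<^esub> x) = \<iota> x" .
  qed
  have Bij: "Ad G M \<iota> g \<in> Bij UNIV" if "g \<in> carrier G" for g
  proof -
    have "bij (Ad G M \<iota> g)"
      using mult[of g "inv\<^bsub>G\<^esub> g"] mult[of "inv\<^bsub>G\<^esub> g" g] that one
      by (intro o_bij[where g = "Ad G M \<iota> (inv\<^bsub>G\<^esub> g)"]) (auto simp: fun_eq_iff)
    then show ?thesis
      by (simp add: Bij_def extensional_def)
  qed
  show ?thesis
    unfolding group_action_def group_hom_def group_hom_axioms_def
    by (intro conjI group_BijGroup is_group)
       (auto simp: hom_def BijGroup_def Bij compose_def fun_eq_iff mult)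
qed

section \<open>Double cosets\<close>

lemma (in group) l_coset_eq_iff:
  assumes H: "subgroup H G" and "a \<in> carrier G" "b \<in> carrier G"
  shows "a <#\<^bsub>G\<^esub> H = b <#\<^bsub>G\<^esub> H \<longleftrightarrow> (\<exists>y\<in>H. a = b \<otimes> y)"
proof
  assume "a <#\<^bsub>G\<^esub> H = b <#\<^bsub>G\<^esub> H"
  moreover have "a \<in> a <#\<^bsub>G\<^esub> H"
    using assms subgroup.one_closed[OF H] by (force simp: l_coset_def)
  ultimately show "\<exists>y\<in>H. a = b \<otimes> y"
    by (auto simp: l_coset_def)
next
  assume "\<exists>y\<in>H. a = b \<otimes> y"
  then have "a \<in> b <#\<^bsub>G\<^esub> H"
    by (auto simp: l_coset_def)
  then show "a <#\<^bsub>G\<^esub> H = b <#\<^bsub>G\<^esub> H"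
    using l_repr_independence[OF _ assms(3) H] by simp
qed

context group_action
begin

lemma inv_into_action:
  assumes "g \<in> carrier G" "x \<in> E"
  shows "inv_into E (\<phi> g) x = \<phi> (inv g) x"
proof -
  obtain y where y: "y \<in> E" "\<phi> g y = x"
    using bij_prop1[OF assms] by blast
  then have "inv_into E (\<phi> g) x = y"
    using inj_prop[OF assms(1)] by auto
  then show ?thesis
    using orbit_sym_aux[OF assms(1) y] by simp
qed

text \<open>
  The orbit of \<open>gH\<close> under the stabilizer \<open>K\<close> of \<open>h\<close> is the set of left cosets in \<open>KgH\<close>. Applying
  \<open>a \<mapsto> a\<^sup>-\<^sup>1 h\<close> to the whole double coset \<open>KgH\<close> absorbs \<open>K\<close> and yields exactly the \<open>H\<close>-orbit of
  \<open>g\<^sup>-\<^sup>1 h\<close>, so the correspondence can be defined without choosing representatives. Conversely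
  \<open>a\<^sup>-\<^sup>1 h = y b\<^sup>-\<^sup>1 h\<close> with \<open>y \<in> H\<close> says that \<open>k = a y b\<^sup>-\<^sup>1\<close> fixes \<open>h\<close>, and then \<open>k b = a y\<close> puts \<open>a\<close>
  and \<open>b\<close> in the same double coset.
\<close>

lemma double_coset_orbits:
  assumes H: "subgroup H G" and h: "h \<in> E"
  defines "K \<equiv> stabilizer G \<phi> h"
  shows "\<exists>\<Gamma>.
    (\<forall>g\<in>carrier G.
       \<Gamma> (orbit (G\<lparr>carrier := K\<rparr>) (\<lambda>k m. k <#\<^bsub>G\<^esub> m) (g <#\<^bsub>G\<^esub> H)) =
       orbit (G\<lparr>carrier := H\<rparr>) \<phi> (\<phi> (inv g) h)) \<and>
    bij_betw \<Gamma>
      (orbits (G\<lparr>carrier := K\<rparr>) {g <#\<^bsub>G\<^esub> H | g. g \<in> carrier G \<and> \<phi> (inv g) h \<in> S} (\<lambda>k m. k <#\<^bsub>G\<^esub> m))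
      (orbits (G\<lparr>carrier := H\<rparr>) (orbit G \<phi> h \<inter> S) \<phi>)"
proof -
  interpret group G
    using group_hom group_hom.axioms(1) by auto
  (* KO g is the K-orbit of the coset gH, HO x the H-orbit of the point x. *)
  define KO where "KO g = orbit (G\<lparr>carrier := K\<rparr>) (\<lambda>k m. k <#\<^bsub>G\<^esub> m) (g <#\<^bsub>G\<^esub> H)" for g
  define HO where "HO x = orbit (G\<lparr>carrier := H\<rparr>) \<phi> x" for x
  define \<Gamma> where "\<Gamma> B = {\<phi> (inv g) h | g. g \<in> carrier G \<and> g <#\<^bsub>G\<^esub> H \<in> B}" for B
  have HG: "y \<in> carrier G" if "y \<in> H" for y
    using subgroup.mem_carrier[OF H that] .
  have K: "subgroup K G"
    unfolding K_def by (rule stabilizer_subgroup[OF h])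
  have KG: "k \<in> carrier G" "\<phi> k h = h" if "k \<in> K" for k
    using that by (auto simp: K_def stabilizer_def)
  have KO: "KO g = {(k \<otimes> g) <#\<^bsub>G\<^esub> H | k. k \<in> K}" if "g \<in> carrier G" for g
  proof -
    have "KO g = (\<lambda>k. k <#\<^bsub>G\<^esub> (g <#\<^bsub>G\<^esub> H)) ` K"
      by (auto simp: KO_def orbit_def)
    also have "\<dots> = (\<lambda>k. (k \<otimes> g) <#\<^bsub>G\<^esub> H) ` K"
      using that KG subgroup.subset[OF H] by (intro image_cong refl lcos_m_assoc) auto
    finally show ?thesis by auto
  qed
  note coset_eq = l_coset_eq_iff[OF H]
  have inE: "\<phi> g h \<in> E" if "g \<in> carrier G" for g
    using element_image[OF that h refl] .
  have \<Gamma>_KO: "\<Gamma> (KO g) = HO (\<phi> (inv g) h)" if g: "g \<in> carrier G" for g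
  proof (intro equalityI subsetI)
    fix x assume "x \<in> \<Gamma> (KO g)"
    then obtain a k where a: "a \<in> carrier G" "x = \<phi> (inv a) h" "k \<in> K"
        "a <#\<^bsub>G\<^esub> H = (k \<otimes> g) <#\<^bsub>G\<^esub> H"
      by (auto simp: \<Gamma>_def KO[OF g])
    then obtain y where y: "y \<in> H" "a = k \<otimes> g \<otimes> y"
      using coset_eq[of a "k \<otimes> g"] KG g by auto
    have "inv k \<in> K"
      using a(3) K by (simp add: subgroup.m_inv_closed)
    then have "x = \<phi> (inv y) (\<phi> (inv g) h)"
      using a y KG g HG h inE composition_rule
      by (simp add: inv_mult_group)
    then show "x \<in> HO (\<phi> (inv g) h)"
      using y subgroup.m_inv_closed[OF H] by (auto simp: HO_def orbit_def)
  next
    fix x assume "x \<in> HO (\<phi> (inv g) h)"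
    then obtain y where y: "y \<in> H" "x = \<phi> y (\<phi> (inv g) h)"
      by (auto simp: HO_def orbit_def)
    then have "x = \<phi> (inv (g \<otimes> inv y)) h"
      using g HG h by (simp add: inv_mult_group composition_rule)
    moreover have "(g \<otimes> inv y) <#\<^bsub>G\<^esub> H = (\<one> \<otimes> g) <#\<^bsub>G\<^esub> H"
      using g y HG subgroup.m_inv_closed[OF H] coset_eq[of "g \<otimes> inv y" g] by auto
    ultimately show "x \<in> \<Gamma> (KO g)"
      using g HG[OF y(1)] subgroup.one_closed[OF K] unfolding \<Gamma>_def KO[OF g]
      by (intro CollectI exI[of _ "g \<otimes> inv y"] conjI exI[of _ \<one>]) simp_all
  qed
  have KO_translate: "KO (k \<otimes> b) = KO b" if k: "k \<in> K" and b: "b \<in> carrier G" for k b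
  proof -
    have sub: "KO (l \<otimes> c) \<subseteq> KO c" if l: "l \<in> K" and c: "c \<in> carrier G" for l c
    proof
      fix B assume "B \<in> KO (l \<otimes> c)"
      then obtain m where "m \<in> K" "B = (m \<otimes> l \<otimes> c) <#\<^bsub>G\<^esub> H"
        using l c KG by (auto simp: KO m_assoc)
      then show "B \<in> KO c"
        using c subgroup.m_closed[OF K _ l] by (auto simp: KO)
    qed
    have "inv k \<otimes> (k \<otimes> b) = b"
      using k b KG by (simp add: m_assoc[symmetric])
    then show ?thesis
      using sub[OF k b] sub[of "inv k" "k \<otimes> b"] k b KG subgroup.m_inv_closed[OF K k] by auto
  qed
  have KO_eq: "KO a = KO b"
    if a: "a \<in> carrier G" and b: "b \<in> carrier G"
      and eq: "HO (\<phi> (inv a) h) = HO (\<phi> (inv b) h)" for a b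
  proof -
    have "\<phi> (inv a) h \<in> HO (\<phi> (inv a) h)"
      using a b inE id_eq_one subgroup.one_closed[OF H]
      unfolding HO_def orbit_def by (auto intro!: exI[of _ \<one>]) (metis inv_closed restrict_apply')
    then obtain y where y: "y \<in> H" "\<phi> (inv a) h = \<phi> y (\<phi> (inv b) h)"
      using eq by (auto simp: HO_def orbit_def)
    define k where "k = a \<otimes> y \<otimes> inv b"
    have kG: "k \<in> carrier G"
      using a b y HG by (simp add: k_def)
    have "\<phi> k h = \<phi> a (\<phi> (inv a) h)"
      using a b y HG h inE by (simp add: k_def composition_rule m_assoc)
    also have "\<dots> = h"
      using orbit_sym_aux[of "inv a" h] a h by simp
    finally have k: "k \<in> K"
      using kG by (simp add: K_def stabilizer_def)
    have "k \<otimes> b = a \<otimes> y"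
      using a b y HG by (simp add: k_def m_assoc)
    then have "(k \<otimes> b) <#\<^bsub>G\<^esub> H = a <#\<^bsub>G\<^esub> H"
      using coset_eq[of "k \<otimes> b" a] a b kG y by blast
    then show ?thesis
      using KO_translate[OF k b] by (simp add: KO_def)
  qed
  let ?X = "{g \<in> carrier G. \<phi> (inv g) h \<in> S}"
  have src: "orbits (G\<lparr>carrier := K\<rparr>) {g <#\<^bsub>G\<^esub> H | g. g \<in> carrier G \<and> \<phi> (inv g) h \<in> S}
      (\<lambda>k m. k <#\<^bsub>G\<^esub> m) = KO ` ?X"
    by (auto simp: orbits_def KO_def)
  have "orbit G \<phi> h \<inter> S = (\<lambda>g. \<phi> (inv g) h) ` ?X"
  proof (intro equalityI subsetI)
    fix x assume "x \<in> orbit G \<phi> h \<inter> S"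
    then obtain g where "g \<in> carrier G" "x = \<phi> g h" "x \<in> S"
      by (auto simp: orbit_def)
    then show "x \<in> (\<lambda>g. \<phi> (inv g) h) ` ?X"
      by (intro image_eqI[of _ _ "inv g"]) simp_all
  qed (auto simp: orbit_def)
  then have tgt: "orbits (G\<lparr>carrier := H\<rparr>) (orbit G \<phi> h \<inter> S) \<phi> = (\<lambda>g. HO (\<phi> (inv g) h)) ` ?X"
    by (auto simp: orbits_def HO_def)
  have "bij_betw \<Gamma> (KO ` ?X) ((\<lambda>g. HO (\<phi> (inv g) h)) ` ?X)"
    unfolding bij_betw_def
    by (auto simp: inj_on_def \<Gamma>_KO KO_eq image_image intro!: image_cong)
  then show ?thesis
    using \<Gamma>_KO unfolding src tgt by (auto simp: KO_def HO_def)
qed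

end

theorem lemma3p7:
  fixes br :: "'v::euclidean_space \<Rightarrow> 'v \<Rightarrow> 'v" and \<tau> :: "'v \<Rightarrow> 'v" and C :: "'v set" and h :: 'v
    and G :: "'g monoid" and M :: "('g, real) manifold"
    and \<iota> :: "'v \<Rightarrow> ('g \<Rightarrow> real) \<Rightarrow> real"
    and Gc :: "'c monoid" and Mc :: "('c, complex) manifold" and \<eta> :: "'g \<Rightarrow> 'c"
    and \<tau>G \<tau>hG :: "'g \<Rightarrow> 'g" and H :: "'g set"
  assumes "modular_compactly_causal br \<tau> C h"
    and "lie_group G M" and "connected_space (mtop M)"
    and "lie_algebra_identification br G M \<iota>"
    and "universal_complexification G M Gc Mc \<eta>"
    and "subtopology (mtop M) (kernel G Gc \<eta>) = discrete_topology (kernel G Gc \<eta>)"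
    and "involutive_lie_automorphism G M \<tau>G" and "integrates M \<iota> \<tau>G \<tau>"
    and "subgroup H G"
    and "openin (subtopology (mtop M) {g \<in> carrier G. \<tau>G g = g}) H"
    and "(\<Union>g\<in>H. Ad G M \<iota> g ` C) = C"
    and "involutive_lie_automorphism G M \<tau>hG" and "integrates M \<iota> \<tau>hG (tau_h br h)"
    and "\<tau>hG ` H = H"
  shows "\<exists>\<Gamma>.
    (\<forall>g\<in>carrier G. g <#\<^bsub>G\<^esub> H \<in> M_alpha G M \<iota> \<tau> H h \<longrightarrow>
       \<Gamma> (orbit (G\<lparr>carrier := G_h G M \<iota> h\<rparr>) (\<lambda>k m. k <#\<^bsub>G\<^esub> m) (g <#\<^bsub>G\<^esub> H)) =
       orbit (G\<lparr>carrier := H\<rparr>) (Ad G M \<iota>) (inv_into UNIV (Ad G M \<iota> g) h)) \<and>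
    bij_betw \<Gamma>
      (orbits (G\<lparr>carrier := G_h G M \<iota> h\<rparr>) (M_alpha G M \<iota> \<tau> H h) (\<lambda>k m. k <#\<^bsub>G\<^esub> m))
      (orbits (G\<lparr>carrier := H\<rparr>) (adjoint_orbit G M \<iota> h \<inter> fixed_part \<tau>) (Ad G M \<iota>))"
proof -
  interpret group_action G UNIV "Ad G M \<iota>"
    by (rule Ad_group_action) fact+
  have inv: "inv_into UNIV (Ad G M \<iota> g) h = Ad G M \<iota> (inv\<^bsub>G\<^esub> g) h" if "g \<in> carrier G" for g
    using inv_into_action[OF that] by simp
  have "g \<in> carrier G \<and> inv_into UNIV (Ad G M \<iota> g) h \<in> fixed_part \<tau> \<longleftrightarrow>
      g \<in> carrier G \<and> Ad G M \<iota> (inv\<^bsub>G\<^esub> g) h \<in> fixed_part \<tau>" for g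
    using inv by auto
  then have src: "M_alpha G M \<iota> \<tau> H h =
      {g <#\<^bsub>G\<^esub> H | g. g \<in> carrier G \<and> Ad G M \<iota> (inv\<^bsub>G\<^esub> g) h \<in> fixed_part \<tau>}"
    unfolding M_alpha_def by (simp only:)
  have stab: "G_h G M \<iota> h = stabilizer G (Ad G M \<iota>) h"
    by (simp add: G_h_def stabilizer_def)
  have tgt: "adjoint_orbit G M \<iota> h = orbit G (Ad G M \<iota>) h"
    by (simp add: adjoint_orbit_def orbit_def)
  from double_coset_orbits[OF \<open>subgroup H G\<close> UNIV_I, of h "fixed_part \<tau>"]
  show ?thesis
    unfolding src stab tgt
  proof (elim exE conjE, intro exI conjI ballI impI)
    fix \<Gamma> g
    assume \<Gamma>: "\<forall>g\<in>carrier G.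
        \<Gamma> (orbit (G\<lparr>carrier := stabilizer G (Ad G M \<iota>) h\<rparr>) (\<lambda>k m. k <#\<^bsub>G\<^esub> m) (g <#\<^bsub>G\<^esub> H)) =
        orbit (G\<lparr>carrier := H\<rparr>) (Ad G M \<iota>) (Ad G M \<iota> (inv\<^bsub>G\<^esub> g) h)"
      and g: "g \<in> carrier G"
    show "\<Gamma> (orbit (G\<lparr>carrier := stabilizer G (Ad G M \<iota>) h\<rparr>) (\<lambda>k m. k <#\<^bsub>G\<^esub> m) (g <#\<^bsub>G\<^esub> H)) =
        orbit (G\<lparr>carrier := H\<rparr>) (Ad G M \<iota>) (inv_into UNIV (Ad G M \<iota> g) h)"
      unfolding inv[OF g] by (rule bspec[OF \<Gamma> g])
  qed
qed

end
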